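(* Let $\mathbf{K}$ be a noncommutative associative ring with division by integers. Then the following formulas are valid for the determinant $edet$ of $n\times n$ matrices $A$ over $\mathbf{K}$: $$sdet(A)=edet(A),$$ and $$edet(I_n)=e,$$ the latter if the ring $\mathbf{K}$ contains the unit $e$, where $I_n$ is the identity $n\times n$ matrix.
   Context: A ring is "with division by integers" if for every nonzero integer $m$ the map $x\mapsto mx$ is bijective on the ring; $\frac1m x$ denotes the inverse image of $x$. $S_n$ is the set of permutations of $\{1,\dots,n\}$, $\tau(\sigma)$ is the number of inversions of $\sigma$, and $S_n^{(e)}$, $S_n^{(o)}$ are the sets of even and odd permutations. For $A=(a_{ij})$ an $n\times n$ matrix over $\mathbf{K}$, the symmetrized Barvinok determinant is $$sdet(A):=\frac1{n!}\sum_{\mu\in S_n}\sum_{\sigma\in S_n}(-1)^{\tau(\sigma)+\tau(\mu)}a_{\mu(1)\sigma(1)}\cdots a_{\mu(n)\sigma(n)},$$ and the noncommutative determinant $edet$ is defined by $$edet(A):=\frac{(-1)^{n-1}}{n!}\Big\{\sum_{l\in L_{n-1}^{(e)}}su(l)^n-\sum_{l\in L_{n-1}^{(o)}}su(l)^n+\sum_{l\in L_n^{(o)}}su(l)^n-\sum_{l\in L_n^{(e)}}su(l)^n\Big\}.$$ For $\sigma\in S_n$ and $1\le i_1<\dots<i_k\le n$, the sequence $l=(a_{i_1\sigma(i_1)},\dots,a_{i_k\sigma(i_k)})$ is a subdiagonal of length $k$ of the diagonal $(a_{1\sigma(1)},\dots,a_{n\sigma(n)})$; subdiagonals are identified by their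 positions $\{(i_1,\sigma(i_1)),\dots,(i_k,\sigma(i_k))\}$ in the matrix. $L_k^{(e)}$ (respectively $L_k^{(o)}$) is the set of all subdiagonals of length $k$ of diagonals with $\sigma\in S_n^{(e)}$ (respectively $\sigma\in S_n^{(o)}$), and $su(l)=\sum_{s=1}^k a_{i_s\sigma(i_s)}$ is the sum of the elements of $l$. For $n=1$, $L_0^{(e)}$ consists of the empty subdiagonal, with $su=0$, and $L_0^{(o)}=\emptyset$.
   Formalization: The prefactor of edet is taken as -1/n! instead of the printed (-1)^{n-1}/n!; the two agree for even n, but for odd n the printed sign is wrong (for n=1 and A=(a) it gives -a while sdet(A)=a). *)

theory Defs
  imports "HOL-Combinatorics.Permutations" "Jordan_Normal_Form.Matrix"
begin

text \<open>
  Rings are of class \<open>ring\<close>: associative, neither commutative nor unital. Hence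
  integer multiples, products of finite sequences and powers cannot go through
  \<open>of_int\<close>, \<open>prod_list\<close> or \<open>(^)\<close>.
\<close>

definition int_mult :: "int \<Rightarrow> 'a :: ab_group_add \<Rightarrow> 'a" where
  "int_mult m x = (if m \<ge> 0 then (\<Sum>i<nat m. x) else - (\<Sum>i<nat (- m). x))"

definition division_by_integers :: "'a :: ab_group_add itself \<Rightarrow> bool" where
  "division_by_integers (K :: 'a itself) \<longleftrightarrow> (\<forall>m :: int. m \<noteq> 0 \<longrightarrow> bij (int_mult m :: 'a \<Rightarrow> 'a))"

text \<open>The element \<open>(1/m) x\<close>; meaningful when multiplication by \<open>m\<close> is bijective.\<close>

definition int_div :: "int \<Rightarrow> 'a :: ab_group_add \<Rightarrow> 'a" where
  "int_div m x = (THE y. int_mult m y = x)"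

text \<open>The product from left to right; the empty product is left unspecified.\<close>

fun mult_list :: "'a :: semigroup_mult list \<Rightarrow> 'a" where
  "mult_list [] = undefined"
| "mult_list [x] = x"
| "mult_list (x # y # zs) = x * mult_list (y # zs)"

definition ring_power :: "'a :: semigroup_mult \<Rightarrow> nat \<Rightarrow> 'a" where
  "ring_power x k = mult_list (replicate k x)"

text \<open>Rows, columns and permuted indices range over \<open>{0..<n}\<close>.\<close>

definition inversions :: "nat \<Rightarrow> (nat \<Rightarrow> nat) \<Rightarrow> nat" where
  "inversions n \<sigma> = card {(i, j). i < j \<and> j < n \<and> \<sigma> i > \<sigma> j}"

definition sdet :: "'a :: ring mat \<Rightarrow> 'a" where
  "sdet A = (let n = dim_row A in
     int_div (fact n)
       (\<Sum>\<mu> | \<mu> permutes {0..<n}. \<Sum>\<sigma> | \<sigma> permutes {0..<n}.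
          int_mult ((- 1) ^ (inversions n \<sigma> + inversions n \<mu>))
            (mult_list (map (\<lambda>i. A $$ (\<mu> i, \<sigma> i)) [0..<n]))))"

text \<open>
  A subdiagonal is represented by its set of positions, so that subdiagonals of
  different diagonals with the same positions are counted once.
\<close>

definition subdiagonals :: "nat \<Rightarrow> nat \<Rightarrow> (nat \<Rightarrow> nat) set \<Rightarrow> (nat \<times> nat) set set" where
  "subdiagonals n k P =
     {l. \<exists>\<sigma>\<in>P. \<exists>I \<subseteq> {0..<n}. card I = k \<and> l = (\<lambda>i. (i, \<sigma> i)) ` I}"

definition even_subdiagonals :: "nat \<Rightarrow> nat \<Rightarrow> (nat \<times> nat) set set" where
  "even_subdiagonals n k = subdiagonals n k {\<sigma>. \<sigma> permutes {0..<n} \<and> evenperm \<sigma>}"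

definition odd_subdiagonals :: "nat \<Rightarrow> nat \<Rightarrow> (nat \<times> nat) set set" where
  "odd_subdiagonals n k = subdiagonals n k {\<sigma>. \<sigma> permutes {0..<n} \<and> \<not> evenperm \<sigma>}"

definition su :: "'a :: ring mat \<Rightarrow> (nat \<times> nat) set \<Rightarrow> 'a" where
  "su A l = (\<Sum>p\<in>l. A $$ p)"

text \<open>
  The prefactor is \<open>- 1 / n!\<close>. In the source it is printed as \<open>(- 1) ^ (n - 1) / n!\<close>,
  which is the same for even \<open>n\<close> but has the wrong sign for odd \<open>n\<close>: for a
  \<open>1 \<times> 1\<close> matrix with entry \<open>a\<close> the bracket is \<open>- a\<close>, so the printed formula
  gives \<open>- a\<close> instead of \<open>a\<close>; for the identity matrix of size 3 it gives \<open>- e\<close>.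
\<close>

definition edet :: "'a :: ring mat \<Rightarrow> 'a" where
  "edet A = (let n = dim_row A in
     int_div (fact n)
       (int_mult (- 1)
         ((\<Sum>l \<in> even_subdiagonals n (n - 1). ring_power (su A l) n)
          - (\<Sum>l \<in> odd_subdiagonals n (n - 1). ring_power (su A l) n)
          + (\<Sum>l \<in> odd_subdiagonals n n. ring_power (su A l) n)
          - (\<Sum>l \<in> even_subdiagonals n n. ring_power (su A l) n))))"

definition is_ring_unit :: "'a :: ring \<Rightarrow> bool" where
  "is_ring_unit e \<longleftrightarrow> (\<forall>x. e * x = x \<and> x * e = x)"

definition identity_mat :: "'a :: ring \<Rightarrow> nat \<Rightarrow> 'a mat" where
  "identity_mat e n = mat n n (\<lambda>(i, j). if i = j then e else 0)"

end

theory Submission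
  imports Defs "HOL-Combinatorics.Multiset_Permutations"
begin

text \<open>
  Substituting \<open>\<sigma> = \<rho> \<circ> \<mu>\<close> in \<open>sdet\<close> leaves the sign of \<open>\<rho>\<close>, and the sum over \<open>\<mu>\<close> is the symmetrized
  product of the entries \<open>x\<^sub>i = a\<^sub>i\<^sub>\<rho>\<^sub>(\<^sub>i\<^sub>)\<close>. By polarization this product is the alternating sum over
  \<open>I \<subseteq> {0..<n}\<close> of the \<open>n\<close>-th powers of \<open>\<Sum>\<^sub>i\<^sub>\<in>\<^sub>I x\<^sub>i\<close>. If \<open>I\<close> omits two indices, composing \<open>\<rho>\<close> with
  their transposition cancels the terms of \<open>I\<close> in pairs, so only \<open>\<bar>I\<bar> \<ge> n - 1\<close> survives; there
  \<open>\<rho>\<close> is determined by its restriction to \<open>I\<close>, so subdiagonals correspond to pairs \<open>(\<rho>, I)\<close>.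
\<close>

section \<open>Integer multiples\<close>

lemma int_mult_one [simp]: "int_mult 1 x = x"
  by (simp add: int_mult_def)

lemma int_mult_uminus: "int_mult (- m) x = - int_mult m x"
  by (cases "m = 0") (auto simp: int_mult_def)

lemma int_mult_minus_one [simp]: "int_mult (- 1) x = - x"
  by (simp add: int_mult_uminus)

lemma int_mult_sum: "int_mult m (\<Sum>t\<in>T. f t) = (\<Sum>t\<in>T. int_mult m (f t))"
  by (simp add: int_mult_def sum_negf sum.swap[of _ T])

lemma int_mult_uminus_right: "int_mult m (- x) = - int_mult m x"
  by (simp add: int_mult_def sum_negf)

text \<open>Multiplication by \<open>a\<close> is additive, so it passes through the repeated sum
  that defines multiplication by \<open>b\<close>.\<close>

lemma int_mult_left_commute: "int_mult a (int_mult b x) = int_mult b (int_mult a x)"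
proof -
  have "int_mult a (int_mult b x)
      = (if b \<ge> 0 then (\<Sum>i<nat b. int_mult a x) else - (\<Sum>i<nat (- b). int_mult a x))"
    unfolding int_mult_def[of b] by (simp add: int_mult_sum int_mult_uminus_right)
  then show ?thesis by (simp add: int_mult_def[of b])
qed

lemma int_div_int_mult:
  assumes "division_by_integers TYPE('a :: ab_group_add)" "m \<noteq> 0"
  shows "int_div m (int_mult m x) = (x :: 'a)"
proof -
  have "inj (int_mult m :: 'a \<Rightarrow> 'a)"
    using assms by (simp add: division_by_integers_def bij_is_inj)
  then show ?thesis by (simp add: int_div_def inj_eq)
qed

text \<open>Doubling is injective, so there is no 2-torsion. Both cancellation arguments below rest
  on this.\<close>

lemma eq_uminus_imp_zero:
  assumes "division_by_integers TYPE('a :: ab_group_add)" "y = - (y :: 'a)"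
  shows "y = 0"
proof -
  have "y + y = 0" using assms(2) by (metis add.left_inverse)
  then have "int_mult 2 y = int_mult 2 0"
    by (simp add: int_mult_def eval_nat_numeral)
  moreover have "inj (int_mult 2 :: 'a \<Rightarrow> 'a)"
    using assms(1) unfolding division_by_integers_def by (simp add: bij_is_inj)
  ultimately show ?thesis by (simp add: inj_eq)
qed

text \<open>Reindexing by \<open>h\<close> turns the sum into its own negative. Fixed points of
  \<open>h\<close> are allowed.\<close>

lemma sum_sign_reversing_involution:
  fixes f :: "'b \<Rightarrow> 'a :: ab_group_add"
  assumes "division_by_integers TYPE('a)"
    and "\<And>t. t \<in> T \<Longrightarrow> h t \<in> T" "\<And>t. t \<in> T \<Longrightarrow> h (h t) = t"
    and "\<And>t. t \<in> T \<Longrightarrow> f (h t) = - f t"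
  shows "sum f T = 0"
proof -
  have "sum f T = (\<Sum>t\<in>T. f (h t))"
    by (rule sum.reindex_bij_witness[of T h h]) (use assms(2,3) in auto)
  also have "\<dots> = - sum f T"
    using assms(4) by (simp add: sum_negf)
  finally show ?thesis by (rule eq_uminus_imp_zero[OF assms(1)])
qed

section \<open>Inversions and the sign\<close>

text \<open>A product over pairs, unlike a count, can be reindexed and split factor by
  factor.\<close>

lemma prod_inversions:
  assumes "\<sigma> permutes {0..<n}"
  shows "(\<Prod>(i, j) | i < j \<and> j < n. if \<sigma> i > \<sigma> j then - 1 else 1) = (- 1 :: int) ^ inversions n \<sigma>"
proof -
  let ?T = "{(i, j). i < j \<and> j < n}"
  have fin: "finite ?T"
    by (rule finite_subset[of _ "{0..<n} \<times> {0..<n}"]) auto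
  have "(\<Prod>(i, j)\<in>?T. if \<sigma> i > \<sigma> j then - 1 else 1)
      = (\<Prod>p\<in>?T. if p \<in> {(i, j). \<sigma> i > \<sigma> j} then - 1 else (1 :: int))"
    by (intro prod.cong) auto
  also have "\<dots> = (\<Prod>p\<in>?T \<inter> {(i, j). \<sigma> i > \<sigma> j}. - 1)"
    using fin by (simp add: prod.If_cases)
  also have "\<dots> = (- 1) ^ card (?T \<inter> {(i, j). \<sigma> i > \<sigma> j})"
    by simp
  also have "?T \<inter> {(i, j). \<sigma> i > \<sigma> j} = {(i, j). i < j \<and> j < n \<and> \<sigma> i > \<sigma> j}"
    by auto
  finally show ?thesis by (simp add: inversions_def)
qed

text \<open>Whether \<open>\<sigma> \<circ> \<tau>\<close> inverts a pair depends on whether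
  \<open>\<tau>\<close> inverts it and whether \<open>\<sigma>\<close> inverts its image under
  \<open>\<tau>\<close>; as \<open>\<tau>\<close> only permutes the pairs, the product over the
  images is that of \<open>\<sigma>\<close> alone.\<close>

lemma minus_one_power_inversions_comp:
  assumes s: "\<sigma> permutes {0..<n}" and t: "\<tau> permutes {0..<n}"
  shows "(- 1 :: int) ^ inversions n (\<sigma> \<circ> \<tau>) = (- 1) ^ inversions n \<sigma> * (- 1) ^ inversions n \<tau>"
proof -
  let ?T = "{(i, j). i < j \<and> j < n}"
  let ?f = "\<lambda>\<pi> (i, j). if \<pi> i > \<pi> j then - 1 else (1 :: int)"
  \<comment> \<open>The action of \<open>\<pi>\<close> on two-element sets, each written as an
    increasing pair.\<close>
  let ?g = "\<lambda>\<pi> (i :: nat, j :: nat). (min (\<pi> i) (\<pi> j :: nat), max (\<pi> i) (\<pi> j))"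
  have inj: "\<pi> i = \<pi> j \<longleftrightarrow> i = j" if "\<pi> permutes {0..<n}" for \<pi> i j
    using permutes_inj[OF that] by (simp add: inj_eq)
  have mem: "?g \<pi> p \<in> ?T" if asm: "\<pi> permutes {0..<n}" "p \<in> ?T" for \<pi> p
  proof -
    obtain i j where p: "p = (i, j)" "i < j" "j < n" using asm(2) by auto
    have "\<pi> i < n" "\<pi> j < n" "\<pi> i \<noteq> \<pi> j"
      using p permutes_in_image[OF asm(1), of i] permutes_in_image[OF asm(1), of j]
        inj[OF asm(1)] by auto
    then show ?thesis by (cases "\<pi> i < \<pi> j") (auto simp: p min_def max_def)
  qed
  have inverse: "?g \<pi>' (?g \<pi> p) = p" if asm: "\<And>i. \<pi>' (\<pi> i) = i" "p \<in> ?T" for \<pi> \<pi>' p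
  proof -
    obtain i j where p: "p = (i, j)" "i < j" using asm(2) by auto
    show ?thesis
      by (cases "\<pi> i \<le> \<pi> j") (use p in \<open>auto simp: asm(1) min_def max_def\<close>)
  qed
  have reindex: "(\<Prod>p\<in>?T. ?f \<sigma> (?g \<tau> p)) = (\<Prod>p\<in>?T. ?f \<sigma> p)"
    by (rule prod.reindex_bij_witness[of ?T "?g (Hilbert_Choice.inv \<tau>)" "?g \<tau>"])
       (simp_all only: mem inverse t permutes_inv permutes_inverses[OF t])
  have "(\<Prod>p\<in>?T. ?f (\<sigma> \<circ> \<tau>) p) = (\<Prod>p\<in>?T. ?f \<sigma> (?g \<tau> p) * ?f \<tau> p)"
  proof (rule prod.cong[OF refl])
    fix p assume "p \<in> ?T"
    then obtain i j where p: "p = (i, j)" "i < j" by auto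
    then have "\<tau> i \<noteq> \<tau> j" "\<sigma> (\<tau> i) \<noteq> \<sigma> (\<tau> j)" by (auto simp: inj[OF s] inj[OF t])
    then show "?f (\<sigma> \<circ> \<tau>) p = ?f \<sigma> (?g \<tau> p) * ?f \<tau> p"
      by (cases "\<tau> i < \<tau> j") (auto simp: p min_def max_def)
  qed
  also have "\<dots> = (\<Prod>p\<in>?T. ?f \<sigma> p) * (\<Prod>p\<in>?T. ?f \<tau> p)"
    by (simp only: prod.distrib reindex)
  finally show ?thesis
    by (simp only: prod_inversions[OF s] prod_inversions[OF t]
        prod_inversions[OF permutes_compose[OF t s]])
qed

text \<open>Besides \<open>(a, b)\<close>, each \<open>k\<close> strictly between contributes
  \<open>(a, k)\<close> and \<open>(k, b)\<close>. What matters later is that the number is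
  odd.\<close>

lemma inversions_transpose:
  assumes "a < b" "b < n"
  shows "inversions n (transpose a b) = 2 * (b - a - 1) + 1"
proof -
  let ?B = "{a<..<b}"
  have "{(i, j). i < j \<and> j < n \<and> transpose a b i > transpose a b j}
      = insert (a, b) (Pair a ` ?B \<union> (\<lambda>k. (k, b)) ` ?B)" (is "?L = ?R")
    using assms by (auto simp: transpose_def split: if_splits)
  moreover have "card ?R = Suc (card (Pair a ` ?B \<union> (\<lambda>k. (k, b)) ` ?B))"
    by (subst card_insert_disjoint) auto
  moreover have "card (Pair a ` ?B \<union> (\<lambda>k. (k, b)) ` ?B) = card ?B + card ?B"
    by (subst card_Un_disjoint) (auto simp: card_image inj_on_def)
  ultimately show ?thesis
    by (simp add: inversions_def)
qed

text \<open>Connects the inversion counts in \<open>sdet\<close> with the parity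
  \<open>evenperm\<close> in \<open>edet\<close>. Both sides are multiplicative, so it suffices to
  compare them on transpositions.\<close>

lemma minus_one_power_inversions:
  assumes "\<sigma> permutes {0..<n}"
  shows "(- 1 :: int) ^ inversions n \<sigma> = sign \<sigma>"
proof -
  have "finite {0..<n}" by simp
  from this assms show ?thesis
  proof (induction rule: permutes_rev_induct)
    case id
    have "{(i, j). i < j \<and> j < n \<and> id i > (id j :: nat)} = {}" by auto
    then show ?case by (simp only: inversions_def) simp
  next
    case (swap a b p)
    have tr: "transpose a b permutes {0..<n}"
      using swap by (intro permutes_swap_id) auto
    \<comment> \<open>The induction gives only \<open>a \<noteq> b\<close>; the other order follows
      by symmetry of \<open>transpose\<close>.\<close>
    have "(- 1 :: int) ^ inversions n (transpose a b) = - 1"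
      if "a < b" "b < n" for a b
      using inversions_transpose[OF that] by simp
    then have "(- 1 :: int) ^ inversions n (transpose a b) = - 1"
      using swap by (metis atLeastLessThan_iff linorder_neqE_nat transpose_commute)
    then have "(- 1 :: int) ^ inversions n (p \<circ> transpose a b) = - sign p"
      using minus_one_power_inversions_comp[OF swap(4) tr] swap by simp
    moreover have "permutation p"
      using swap(4) finite_atLeastLessThan unfolding permutation_permutes by blast
    then have "sign (p \<circ> transpose a b) = - sign p"
      using swap(3) by (simp only: sign_compose permutation_swap_id sign_swap_id) simp
    ultimately show ?case by (simp only:)
  qed
qed

section \<open>Polarization\<close>

lemma lists_length_Suc:
  "{xs. set xs \<subseteq> I \<and> length xs = Suc k} = (\<lambda>(x, xs). x # xs) ` (I \<times> {xs. set xs \<subseteq> I \<and> length xs = k})"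
  by (force simp: length_Suc_conv)

text \<open>Distributivity without commutativity: the power expands into words, one for each choice
  of a summand in every factor.\<close>

lemma ring_power_sum:
  fixes x :: "'b \<Rightarrow> 'a :: ring"
  assumes "k > 0"
  shows "ring_power (\<Sum>i\<in>I. x i) k = (\<Sum>xs | set xs \<subseteq> I \<and> length xs = k. mult_list (map x xs))"
  using assms
proof (induction k rule: nat_induct_non_zero)
  case 1
  have "{xs. set xs \<subseteq> I \<and> length xs = 1} = (\<lambda>i. [i]) ` I"
    by (auto simp: length_Suc_conv)
  then show ?case
    by (simp add: ring_power_def sum.reindex inj_on_def)
next
  case (Suc k)
  let ?L = "{xs. set xs \<subseteq> I \<and> length xs = k}"
  \<comment> \<open>A nonempty tail is what lets the recursive equation of \<open>mult_list\<close>
    apply.\<close>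
  obtain k' where k': "k = Suc k'" using Suc.hyps by (cases k) auto
  have "ring_power (\<Sum>i\<in>I. x i) (Suc k) = (\<Sum>i\<in>I. x i) * (\<Sum>xs\<in>?L. mult_list (map x xs))"
    unfolding Suc.IH[symmetric] by (simp add: ring_power_def k')
  also have "\<dots> = (\<Sum>(i, xs)\<in>I \<times> ?L. x i * mult_list (map x xs))"
    by (simp add: sum_product sum.cartesian_product)
  also have "\<dots> = (\<Sum>(i, xs)\<in>I \<times> ?L. mult_list (map x (i # xs)))"
    by (intro sum.cong) (auto simp: k' length_Suc_conv)
  also have "\<dots> = (\<Sum>xs | set xs \<subseteq> I \<and> length xs = Suc k. mult_list (map x xs))"
    unfolding lists_length_Suc by (subst sum.reindex) (auto simp: inj_on_def intro!: sum.cong)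
  finally show ?case .
qed

text \<open>Adding or removing one fixed element of \<open>N - S\<close> pairs the supersets with
  opposite signs.\<close>

lemma sum_supersets_alternating:
  fixes y :: "'a :: ab_group_add"
  assumes div: "division_by_integers TYPE('a)" and "finite N" "S \<subset> N"
  shows "(\<Sum>I | S \<subseteq> I \<and> I \<subseteq> N. int_mult ((- 1) ^ (card N - card I)) y) = 0"
proof -
  obtain k where k: "k \<in> N" "k \<notin> S" using assms by blast
  define h where "h I = (if k \<in> I then I - {k} else insert k I)" for I
  show ?thesis
  proof (rule sum_sign_reversing_involution[OF div, where h = h])
    fix I assume I: "I \<in> {I. S \<subseteq> I \<and> I \<subseteq> N}"
    \<comment> \<open>The bound keeps the natural subtraction in the exponent from
      truncating.\<close>
    then have fin: "finite I" and le: "card I \<le> card N"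
      using \<open>finite N\<close> finite_subset card_mono by auto
    show "h I \<in> {I. S \<subseteq> I \<and> I \<subseteq> N}" "h (h I) = I"
      using I k by (auto simp: h_def)
    show "int_mult ((- 1) ^ (card N - card (h I))) y = - int_mult ((- 1) ^ (card N - card I)) y"
    proof (cases "k \<in> I")
      case True
      then have "card I = Suc (card (h I))"
        using fin by (simp only: h_def if_True card_Suc_Diff1)
      then have "card N - card (h I) = Suc (card N - card I)" using le by simp
      then show ?thesis by (simp add: int_mult_uminus)
    next
      case False
      then have "card (h I) = Suc (card I)"
        using fin by (simp add: h_def)
      moreover have "card (h I) \<le> card N"
        using I k False \<open>finite N\<close> by (intro card_mono) (auto simp: h_def)
      ultimately have "card N - card I = Suc (card N - card (h I))" by simp
      then show ?thesis by (simp add: int_mult_uminus)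
    qed
  qed
qed

text \<open>After expanding the powers, a word receives the alternating sum over all
  \<open>I\<close> containing its letters, which vanishes unless the word uses every element of
  \<open>N\<close>.\<close>

lemma polarization:
  fixes x :: "'b \<Rightarrow> 'a :: ring"
  assumes div: "division_by_integers TYPE('a)" and fin: "finite N" and ne: "N \<noteq> {}"
  shows "(\<Sum>xs\<in>permutations_of_set N. mult_list (map x xs))
    = (\<Sum>I\<in>Pow N. int_mult ((- 1) ^ (card N - card I)) (ring_power (\<Sum>i\<in>I. x i) (card N)))"
proof -
  let ?L = "{xs. set xs \<subseteq> N \<and> length xs = card N}"
  let ?P = "\<lambda>xs. mult_list (map x xs)"
  let ?c = "\<lambda>I. (- 1) ^ (card N - card I) :: int"
  have finL: "finite ?L" using fin by (rule finite_lists_length_eq)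
  have pos: "card N > 0" using fin ne by (simp add: card_gt_0_iff)
  \<comment> \<open>All expansions are put over one set of words independent of \<open>I\<close>, so
    that the two sums can be exchanged.\<close>
  have "int_mult (?c I) (ring_power (\<Sum>i\<in>I. x i) (card N))
      = (\<Sum>xs\<in>?L. if set xs \<subseteq> I then int_mult (?c I) (?P xs) else 0)" if "I \<in> Pow N" for I
  proof -
    have "{xs. set xs \<subseteq> I \<and> length xs = card N} = {xs \<in> ?L. set xs \<subseteq> I}"
      using that by auto
    then show ?thesis
      by (simp only: ring_power_sum[OF pos] int_mult_sum sum.inter_filter[OF finL, symmetric])
  qed
  then have "(\<Sum>I\<in>Pow N. int_mult (?c I) (ring_power (\<Sum>i\<in>I. x i) (card N)))
      = (\<Sum>I\<in>Pow N. \<Sum>xs\<in>?L. if set xs \<subseteq> I then int_mult (?c I) (?P xs) else 0)"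
    by (intro sum.cong) auto
  also have "\<dots> = (\<Sum>xs\<in>?L. \<Sum>I\<in>Pow N. if set xs \<subseteq> I then int_mult (?c I) (?P xs) else 0)"
    by (rule sum.swap)
  also have "\<dots> = (\<Sum>xs\<in>?L. \<Sum>I | set xs \<subseteq> I \<and> I \<subseteq> N. int_mult (?c I) (?P xs))"
  proof (rule sum.cong[OF refl])
    fix xs
    have "{I. set xs \<subseteq> I \<and> I \<subseteq> N} = {I \<in> Pow N. set xs \<subseteq> I}" by auto
    then show "(\<Sum>I\<in>Pow N. if set xs \<subseteq> I then int_mult (?c I) (?P xs) else 0)
        = (\<Sum>I | set xs \<subseteq> I \<and> I \<subseteq> N. int_mult (?c I) (?P xs))"
      using fin by (simp only: sum.inter_filter[symmetric] finite_Pow_iff)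
  qed
  also have "\<dots> = (\<Sum>xs\<in>?L. if set xs = N then ?P xs else 0)"
  proof (rule sum.cong[OF refl])
    fix xs assume xs: "xs \<in> ?L"
    show "(\<Sum>I | set xs \<subseteq> I \<and> I \<subseteq> N. int_mult (?c I) (?P xs)) = (if set xs = N then ?P xs else 0)"
    proof (cases "set xs = N")
      case True
      then have "{I. set xs \<subseteq> I \<and> I \<subseteq> N} = {N}" by auto
      then show ?thesis using True by simp
    next
      case False
      then have "set xs \<subset> N" using xs by auto
      then show ?thesis
        using sum_supersets_alternating[OF div fin] False by simp
    qed
  qed
  also have "\<dots> = (\<Sum>xs | xs \<in> ?L \<and> set xs = N. ?P xs)"
    by (simp only: sum.inter_filter[OF finL])
  \<comment> \<open>A word of length \<open>card N\<close> that uses every letter has no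
    repetition.\<close>
  also have "{xs. xs \<in> ?L \<and> set xs = N} = permutations_of_set N"
    by (auto simp: permutations_of_set_def distinct_card intro: card_distinct)
  finally show ?thesis by simp
qed

lemma sum_permutes_eq_sum_permutations_of_set:
  "(\<Sum>\<mu> | \<mu> permutes {0..<n}. f (map \<mu> [0..<n])) = (\<Sum>xs\<in>permutations_of_set {0..<n}. f xs)"
\<comment> \<open>The function built from a list is the identity from \<open>n\<close> on, as
  \<open>permutes\<close> demands.\<close>
proof (rule sum.reindex_bij_witness[of _ "\<lambda>xs i. if i < n then xs ! i else i" "\<lambda>\<mu>. map \<mu> [0..<n]"])
  fix \<mu> :: "nat \<Rightarrow> nat" assume \<mu>: "\<mu> \<in> {\<mu>. \<mu> permutes {0..<n}}"
  then show "(\<lambda>i. if i < n then map \<mu> [0..<n] ! i else i) = \<mu>"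
    by (auto simp: permutes_def)
  show "map \<mu> [0..<n] \<in> permutations_of_set {0..<n}"
    using \<mu> permutes_image[of \<mu> "{0..<n}"]
    by (simp add: permutations_of_set_def distinct_map permutes_inj_on)
next
  fix xs assume "xs \<in> permutations_of_set {0..<n}"
  then have xs: "set xs = {0..<n}" "distinct xs" and len: "length xs = n"
    using distinct_card by (force simp: permutations_of_set_def)+
  show "map (\<lambda>i. if i < n then xs ! i else i) [0..<n] = xs"
    using len by (intro nth_equalityI) auto
  have "bij_betw ((!) xs) {0..<n} {0..<n}"
    using bij_betw_nth[OF xs(2)] xs(1) len by (simp add: atLeast0LessThan)
  then have "bij_betw (\<lambda>i. if i < n then xs ! i else i) {0..<n} {0..<n}"
    by (rule bij_betw_cong[THEN iffD1, rotated]) auto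
  then show "(\<lambda>i. if i < n then xs ! i else i) \<in> {\<mu>. \<mu> permutes {0..<n}}"
    by (auto intro: bij_imp_permutes)
qed auto

section \<open>Subdiagonals\<close>

text \<open>A set of positions could come from several diagonals and would still be counted once.
  The bound on \<open>k\<close> excludes this: with at most one row missing, the positions determine
  the permutation.\<close>

lemma sum_subdiagonals:
  assumes P: "\<And>\<sigma>. \<sigma> \<in> P \<Longrightarrow> \<sigma> permutes {0..<n}" and k: "n \<le> Suc k"
  shows "(\<Sum>l\<in>subdiagonals n k P. g l)
    = (\<Sum>\<sigma>\<in>P. \<Sum>I | I \<subseteq> {0..<n} \<and> card I = k. g ((\<lambda>i. (i, \<sigma> i)) ` I))"
proof -
  let ?K = "{I. I \<subseteq> {0..<n} \<and> card I = k}"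
  let ?l = "\<lambda>(\<sigma>, I). (\<lambda>i. (i, \<sigma> i)) ` I"
  have finP: "finite P"
    by (rule finite_subset[of _ "{\<sigma>. \<sigma> permutes {0..<n}}"]) (auto simp: P finite_permutations)
  have inj: "inj_on ?l (P \<times> ?K)"
  proof (rule inj_onI, clarify)
    fix \<sigma> I \<tau> J
    assume mem: "\<sigma> \<in> P" "\<tau> \<in> P" "I \<subseteq> {0..<n}" "J \<subseteq> {0..<n}" "k = card I"
      and eq: "(\<lambda>i. (i, \<sigma> i)) ` I = (\<lambda>i. (i, \<tau> i)) ` J"
    \<comment> \<open>The row coordinates of the positions recover the index set.\<close>
    have "fst ` (\<lambda>i. (i, \<sigma> i)) ` I = fst ` (\<lambda>i. (i, \<tau> i)) ` J"
      by (simp only: eq)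
    then have IJ: "I = J" by (simp add: image_image)
    have agree: "\<sigma> i = \<tau> i" if "i \<in> I" for i
      using eq that by (auto simp: IJ image_iff set_eq_iff)
    have \<sigma>: "\<sigma> permutes {0..<n}" and \<tau>: "\<tau> permutes {0..<n}"
      using mem P by auto
    have finI: "finite I" using mem(3) finite_subset by blast
    have "card ({0..<n} - I) \<le> 1"
      using mem(3,5) k by (simp add: card_Diff_subset finI)
    \<comment> \<open>At most one index is missing from \<open>I\<close>, and bijectivity forces the value there.\<close>
    moreover have "\<sigma> ` ({0..<n} - I) = \<tau> ` ({0..<n} - I)"
    proof -
      have "\<sigma> ` ({0..<n} - I) = {0..<n} - \<sigma> ` I" "\<tau> ` ({0..<n} - I) = {0..<n} - \<tau> ` I"
        by (simp_all only: image_set_diff[OF permutes_inj[OF \<sigma>]]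
            image_set_diff[OF permutes_inj[OF \<tau>]] permutes_image[OF \<sigma>] permutes_image[OF \<tau>])
      moreover have "\<sigma> ` I = \<tau> ` I" using agree by (intro image_cong) auto
      ultimately show ?thesis by simp
    qed
    ultimately have agree': "\<sigma> i = \<tau> i" if "i \<in> {0..<n} - I" for i
    proof -
      have "{0..<n} - I = {i}"
        using \<open>card ({0..<n} - I) \<le> 1\<close> that
        by (metis card_le_Suc0_iff_eq One_nat_def finite_Diff finite_atLeastLessThan
            is_singletonI' is_singleton_def singletonD empty_iff)
      with \<open>\<sigma> ` ({0..<n} - I) = \<tau> ` ({0..<n} - I)\<close> show ?thesis by simp
    qed
    have "\<sigma> = \<tau>"
    proof
      fix i
      show "\<sigma> i = \<tau> i"
        using agree agree' permutes_not_in[OF \<sigma>, of i] permutes_not_in[OF \<tau>, of i]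
        by (cases "i \<in> {0..<n}"; cases "i \<in> I") auto
    qed
    with IJ show "\<sigma> = \<tau> \<and> I = J" by simp
  qed
  have "subdiagonals n k P = ?l ` (P \<times> ?K)"
    by (auto simp: subdiagonals_def image_iff)
  then have "(\<Sum>l\<in>subdiagonals n k P. g l) = (\<Sum>p\<in>P \<times> ?K. g (?l p))"
    by (simp add: sum.reindex[OF inj] o_def)
  also have "\<dots> = (\<Sum>\<sigma>\<in>P. \<Sum>I\<in>?K. g (?l (\<sigma>, I)))"
    by (simp only: sum.cartesian_product case_prod_unfold prod.sel)
  finally show ?thesis by simp
qed

lemma su_subdiagonal: "su A ((\<lambda>i. (i, \<sigma> i)) ` I) = (\<Sum>i\<in>I. A $$ (i, \<sigma> i))"
  unfolding su_def by (subst sum.reindex) (auto simp: inj_on_def)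

lemma sum_sign_permutes:
  fixes n :: nat
  shows "(\<Sum>\<sigma> | \<sigma> permutes {0..<n}. int_mult (sign \<sigma>) (f \<sigma>))
    = (\<Sum>\<sigma> | \<sigma> permutes {0..<n} \<and> evenperm \<sigma>. f \<sigma>)
      - (\<Sum>\<sigma> | \<sigma> permutes {0..<n} \<and> \<not> evenperm \<sigma>. f \<sigma>)"
proof -
  have fin: "finite {\<sigma>. \<sigma> permutes {0..<n}}" by (simp add: finite_permutations)
  have "int_mult (sign \<sigma>) (f \<sigma>)
      = (if evenperm \<sigma> then f \<sigma> else 0) - (if \<not> evenperm \<sigma> then f \<sigma> else 0)" for \<sigma>
    by (simp add: sign_def)
  then have "(\<Sum>\<sigma> | \<sigma> permutes {0..<n}. int_mult (sign \<sigma>) (f \<sigma>))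
      = (\<Sum>\<sigma> | \<sigma> permutes {0..<n}. if evenperm \<sigma> then f \<sigma> else 0)
        - (\<Sum>\<sigma> | \<sigma> permutes {0..<n}. if \<not> evenperm \<sigma> then f \<sigma> else 0)"
    by (simp only: sum_subtractf)
  then show ?thesis
    by (simp only: sum.inter_filter[OF fin, symmetric] mem_Collect_eq)
qed

section \<open>The determinants\<close>

text \<open>Collects the contributions of all diagonals for a fixed row set \<open>I\<close>, since
  the cancellation takes place separately for each \<open>I\<close>.\<close>

definition signed_power_sum :: "'a :: ring mat \<Rightarrow> nat \<Rightarrow> nat set \<Rightarrow> 'a" where
  "signed_power_sum A n I
    = (\<Sum>\<sigma> | \<sigma> permutes {0..<n}. int_mult (sign \<sigma>) (ring_power (\<Sum>i\<in>I. A $$ (i, \<sigma> i)) n))"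

lemma even_minus_odd_subdiagonals:
  assumes "n \<le> Suc k"
  shows "(\<Sum>l\<in>even_subdiagonals n k. ring_power (su A l) n)
      - (\<Sum>l\<in>odd_subdiagonals n k. ring_power (su A l) n)
    = (\<Sum>I | I \<subseteq> {0..<n} \<and> card I = k. signed_power_sum A n I)"
proof -
  have "(\<Sum>l\<in>subdiagonals n k {\<sigma>. \<sigma> permutes {0..<n} \<and> Q \<sigma>}. ring_power (su A l) n)
      = (\<Sum>I | I \<subseteq> {0..<n} \<and> card I = k. \<Sum>\<sigma> | \<sigma> permutes {0..<n} \<and> Q \<sigma>.
          ring_power (\<Sum>i\<in>I. A $$ (i, \<sigma> i)) n)" for Q
    by (subst sum_subdiagonals) (use assms in \<open>auto simp: su_subdiagonal intro: sum.swap\<close>)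
  then show ?thesis
    by (simp add: even_subdiagonals_def odd_subdiagonals_def signed_power_sum_def
        sum_sign_permutes sum_subtractf)
qed

text \<open>Composing with a transposition of two indices outside \<open>I\<close> changes only the sign.\<close>

lemma signed_power_sum_eq_0:
  fixes A :: "'a :: ring mat"
  assumes div: "division_by_integers TYPE('a)" and I: "I \<subseteq> {0..<n}" "card I + 2 \<le> n"
  shows "signed_power_sum A n I = 0"
proof -
  have finI: "finite I" using I(1) finite_subset by blast
  have "\<not> card ({0..<n} - I) \<le> Suc 0"
    using I by (simp add: card_Diff_subset finI)
  then obtain a b where ab: "a \<in> {0..<n} - I" "b \<in> {0..<n} - I" "a \<noteq> b"
    by (auto simp: card_le_Suc0_iff_eq)
  have tr: "transpose a b permutes {0..<n}"
    using ab by (intro permutes_swap_id) auto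
  show ?thesis
    unfolding signed_power_sum_def
  proof (rule sum_sign_reversing_involution[OF div, where h = "\<lambda>\<sigma>. \<sigma> \<circ> transpose a b"])
    fix \<sigma> assume "\<sigma> \<in> {\<sigma>. \<sigma> permutes {0..<n}}"
    then have \<sigma>: "\<sigma> permutes {0..<n}" by simp
    show "\<sigma> \<circ> transpose a b \<in> {\<sigma>. \<sigma> permutes {0..<n}}"
      using permutes_compose[OF tr \<sigma>] by simp
    show "\<sigma> \<circ> transpose a b \<circ> transpose a b = \<sigma>"
      by (simp add: fun_eq_iff)
    have "permutation \<sigma>"
      using \<sigma> finite_atLeastLessThan unfolding permutation_permutes by blast
    then have "sign (\<sigma> \<circ> transpose a b) = - sign \<sigma>"
      using ab(3) by (simp only: sign_compose permutation_swap_id sign_swap_id) simp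
    moreover have "(\<Sum>i\<in>I. A $$ (i, (\<sigma> \<circ> transpose a b) i)) = (\<Sum>i\<in>I. A $$ (i, \<sigma> i))"
      using ab by (intro sum.cong) (auto simp: transpose_def)
    ultimately show "int_mult (sign (\<sigma> \<circ> transpose a b))
          (ring_power (\<Sum>i\<in>I. A $$ (i, (\<sigma> \<circ> transpose a b) i)) n)
        = - int_mult (sign \<sigma>) (ring_power (\<Sum>i\<in>I. A $$ (i, \<sigma> i)) n)"
      by (simp only: int_mult_uminus)
  qed
qed

text \<open>Row sets missing two or more indices contribute zero; the two remaining sizes carry the
  coefficients 1 and -1.\<close>

lemma sum_Pow_signed_power_sum:
  fixes A :: "'a :: ring mat"
  assumes div: "division_by_integers TYPE('a)" and n: "n \<ge> 1"
  shows "(\<Sum>I\<in>Pow {0..<n}. int_mult ((- 1) ^ (n - card I)) (signed_power_sum A n I))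
    = (\<Sum>I | I \<subseteq> {0..<n} \<and> card I = n. signed_power_sum A n I)
      - (\<Sum>I | I \<subseteq> {0..<n} \<and> card I = n - 1. signed_power_sum A n I)"
proof -
  let ?K = "\<lambda>k. {I. I \<subseteq> {0..<n} \<and> card I = k}"
  let ?f = "\<lambda>I. int_mult ((- 1) ^ (n - card I)) (signed_power_sum A n I)"
  have fin: "finite (?K k)" for k
    by (rule finite_subset[of _ "Pow {0..<n}"]) auto
  have "(\<Sum>I\<in>Pow {0..<n}. ?f I) = (\<Sum>I\<in>?K n \<union> ?K (n - 1). ?f I)"
  proof (rule sum.mono_neutral_right)
    show "\<forall>I\<in>Pow {0..<n} - (?K n \<union> ?K (n - 1)). ?f I = 0"
    proof
      fix I assume I: "I \<in> Pow {0..<n} - (?K n \<union> ?K (n - 1))"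
      then have "card I \<le> n" using card_mono[of "{0..<n}" I] by auto
      with I have "card I + 2 \<le> n" by auto
      then show "?f I = 0"
        using I signed_power_sum_eq_0[OF div] by (auto simp: int_mult_def)
    qed
  qed auto
  also have "\<dots> = (\<Sum>I\<in>?K n. ?f I) + (\<Sum>I\<in>?K (n - 1). ?f I)"
    \<comment> \<open>For \<open>n \<ge> 1\<close> the sizes \<open>n\<close> and
      \<open>n - 1\<close> differ, so the two families are disjoint.\<close>
    using n by (intro sum.union_disjoint fin) auto
  finally show ?thesis using n by (simp add: sum_negf)
qed

text \<open>This is \<open>sdet\<close> before division by \<open>n!\<close>, indexed by
  \<open>\<rho>\<close> with \<open>\<sigma> = \<rho> \<circ> \<mu>\<close>. For fixed
  \<open>\<rho>\<close> the factors are the entries of one diagonal, and \<open>\<mu>\<close> only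
  orders them.\<close>

definition sdet_sum :: "'a :: ring mat \<Rightarrow> nat \<Rightarrow> 'a" where
  "sdet_sum A n = (\<Sum>\<mu> | \<mu> permutes {0..<n}. \<Sum>\<rho> | \<rho> permutes {0..<n}.
     int_mult (sign \<rho>) (mult_list (map (\<lambda>i. A $$ (\<mu> i, \<rho> (\<mu> i))) [0..<n])))"

text \<open>Substitute \<open>\<sigma> = \<rho> \<circ> \<mu>\<close>.\<close>

lemma sdet_eq:
  assumes "dim_row A = n"
  shows "sdet A = int_div (fact n) (sdet_sum A n)"
proof -
  let ?S = "{\<sigma>. \<sigma> permutes {0..<n}}"
  have eq: "(\<Sum>\<sigma>\<in>?S. int_mult ((- 1) ^ (inversions n \<sigma> + inversions n \<mu>))
        (mult_list (map (\<lambda>i. A $$ (\<mu> i, \<sigma> i)) [0..<n])))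
      = (\<Sum>\<rho>\<in>?S. int_mult (sign \<rho>) (mult_list (map (\<lambda>i. A $$ (\<mu> i, \<rho> (\<mu> i))) [0..<n])))"
    if "\<mu> \<in> ?S" for \<mu>
  proof (rule sum.reindex_bij_witness[of _ "\<lambda>\<rho>. \<rho> \<circ> \<mu>" "\<lambda>\<sigma>. \<sigma> \<circ> Hilbert_Choice.inv \<mu>"])
    have \<mu>: "\<mu> permutes {0..<n}" using that by simp
    fix \<sigma> assume "\<sigma> \<in> ?S"
    then have \<sigma>: "\<sigma> permutes {0..<n}" by simp
    have perm: "permutation \<pi>" if "\<pi> permutes {0..<n}" for \<pi>
      using that finite_atLeastLessThan unfolding permutation_permutes by blast
    show "\<sigma> \<circ> Hilbert_Choice.inv \<mu> \<circ> \<mu> = \<sigma>" "\<sigma> \<circ> \<mu> \<circ> Hilbert_Choice.inv \<mu> = \<sigma>"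
      by (simp_all add: fun_eq_iff permutes_inverses[OF \<mu>])
    show "\<sigma> \<circ> Hilbert_Choice.inv \<mu> \<in> ?S" "\<sigma> \<circ> \<mu> \<in> ?S"
      using permutes_compose[OF permutes_inv[OF \<mu>] \<sigma>] permutes_compose[OF \<mu> \<sigma>] by simp_all
    \<comment> \<open>A permutation and its inverse have the same sign.\<close>
    have "sign (\<sigma> \<circ> Hilbert_Choice.inv \<mu>) = (- 1) ^ (inversions n \<sigma> + inversions n \<mu>)"
      by (simp only: sign_compose perm \<sigma> \<mu> permutes_inv sign_inverse power_add
          minus_one_power_inversions)
    then show "int_mult (sign (\<sigma> \<circ> Hilbert_Choice.inv \<mu>))
          (mult_list (map (\<lambda>i. A $$ (\<mu> i, (\<sigma> \<circ> Hilbert_Choice.inv \<mu>) (\<mu> i))) [0..<n]))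
        = int_mult ((- 1) ^ (inversions n \<sigma> + inversions n \<mu>))
          (mult_list (map (\<lambda>i. A $$ (\<mu> i, \<sigma> i)) [0..<n]))"
      by (simp only: o_apply permutes_inverses[OF \<mu>])
  qed
  show ?thesis
    unfolding sdet_def Let_def assms sdet_sum_def
    by (rule arg_cong[where f = "int_div (fact n)", OF sum.cong[OF refl eq]])
qed

text \<open>For fixed \<open>\<rho>\<close> the sum over \<open>\<mu>\<close> is a symmetrized
  product, to which \<open>polarization\<close> applies; exchanging the sums over
  \<open>\<rho>\<close> and \<open>I\<close> then groups the terms by row set.\<close>

lemma sdet_sum_eq:
  fixes A :: "'a :: ring mat"
  assumes div: "division_by_integers TYPE('a)" and n: "n \<ge> 1"
  shows "sdet_sum A n
    = (\<Sum>I\<in>Pow {0..<n}. int_mult ((- 1) ^ (n - card I)) (signed_power_sum A n I))"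
proof -
  let ?S = "{\<sigma>. \<sigma> permutes {0..<n}}"
  let ?p = "\<lambda>\<rho> I. ring_power (\<Sum>i\<in>I. A $$ (i, \<rho> i)) n"
  have polar: "(\<Sum>\<mu>\<in>?S. mult_list (map x (map \<mu> [0..<n])))
      = (\<Sum>I\<in>Pow {0..<n}. int_mult ((- 1) ^ (n - card I)) (ring_power (\<Sum>i\<in>I. x i) n))"
    for x :: "nat \<Rightarrow> 'a"
    using sum_permutes_eq_sum_permutations_of_set[where n = n and f = "\<lambda>xs. mult_list (map x xs)"]
      polarization[OF div, of "{0..<n}" x] n by (simp del: map_map)
  have "sdet_sum A n = (\<Sum>\<rho>\<in>?S. int_mult (sign \<rho>)
      (\<Sum>\<mu>\<in>?S. mult_list (map (\<lambda>i. A $$ (i, \<rho> i)) (map \<mu> [0..<n]))))"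
    unfolding sdet_sum_def by (subst sum.swap) (simp add: int_mult_sum o_def)
  also have "\<dots> = (\<Sum>\<rho>\<in>?S. int_mult (sign \<rho>)
      (\<Sum>I\<in>Pow {0..<n}. int_mult ((- 1) ^ (n - card I)) (?p \<rho> I)))"
    by (simp only: polar)
  also have "\<dots> = (\<Sum>I\<in>Pow {0..<n}. \<Sum>\<rho>\<in>?S.
      int_mult ((- 1) ^ (n - card I)) (int_mult (sign \<rho>) (?p \<rho> I)))"
    \<comment> \<open>Fixing the outer multiplier to a sign orients the commutation rule, which
      would otherwise be symmetric.\<close>
    by (subst sum.swap) (simp only: int_mult_sum int_mult_left_commute[of "sign _"])
  finally show ?thesis by (simp only: signed_power_sum_def int_mult_sum)
qed

text \<open>The division by \<open>n!\<close> is common to both sides, so the double sum need only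
  be matched with the negated bracket of \<open>edet\<close>.\<close>

lemma sdet_eq_edet:
  fixes A :: "'a :: ring mat"
  assumes div: "division_by_integers TYPE('a)" and n: "n \<ge> 1" and A: "dim_row A = n"
  shows "sdet A = edet A"
proof -
  let ?E = "\<lambda>k. \<Sum>l\<in>even_subdiagonals n k. ring_power (su A l) n"
  let ?O = "\<lambda>k. \<Sum>l\<in>odd_subdiagonals n k. ring_power (su A l) n"
  have "sdet_sum A n = (?E n - ?O n) - (?E (n - 1) - ?O (n - 1))"
    using n by (simp add: sdet_sum_eq[OF div n] sum_Pow_signed_power_sum[OF div n]
        even_minus_odd_subdiagonals)
  also have "\<dots> = int_mult (- 1) (?E (n - 1) - ?O (n - 1) + ?O n - ?E n)"
    by simp
  finally show ?thesis
    unfolding edet_def Let_def A by (simp only: sdet_eq[OF A])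
qed

section \<open>Value on the identity matrix\<close>

lemma mult_list_zero:
  assumes "(0 :: 'a :: ring) \<in> set xs"
  shows "mult_list xs = 0"
  using assms by (induction xs rule: mult_list.induct) auto

lemma mult_list_unit:
  assumes "is_ring_unit e" "k > 0"
  shows "mult_list (replicate k e) = e"
  using assms(2)
proof (induction k rule: nat_induct_non_zero)
  case (Suc k)
  then show ?case using assms(1) by (cases k) (auto simp: is_ring_unit_def)
qed simp

text \<open>Only \<open>\<rho> = id\<close> survives, and each of the \<open>n!\<close> orderings
  \<open>\<mu>\<close> then contributes \<open>e\<close>.\<close>

lemma sdet_sum_identity:
  assumes e: "is_ring_unit e" and n: "n \<ge> 1"
  shows "sdet_sum (identity_mat e n) n = int_mult (fact n) e"
proof -
  let ?S = "{\<sigma>. \<sigma> permutes {0..<n}}"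
  let ?m = "\<lambda>\<mu> \<rho>. mult_list (map (\<lambda>i. identity_mat e n $$ (\<mu> i, \<rho> (\<mu> i))) [0..<n])"
  have fin: "finite ?S" by (simp add: finite_permutations)
  have lt: "\<pi> i < n" if "\<pi> permutes {0..<n}" "i < n" for \<pi> i
    using permutes_in_image[OF that(1), of i] that(2) by simp
  have "(\<Sum>\<rho>\<in>?S. int_mult (sign \<rho>) (?m \<mu> \<rho>)) = e" if \<mu>: "\<mu> permutes {0..<n}" for \<mu>
  proof -
    have "?m \<mu> \<rho> = 0" if \<rho>: "\<rho> permutes {0..<n}" "\<rho> \<noteq> id" for \<rho>
    proof -
      obtain j where j: "\<rho> j \<noteq> j" using \<rho>(2) by (auto simp: fun_eq_iff)
      then have "j < n" using permutes_not_in[OF \<rho>(1), of j] by auto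
      \<comment> \<open>Surjectivity of \<open>\<mu>\<close> guarantees a factor from row
        \<open>j\<close>, and that factor is off the diagonal.\<close>
      then have "j \<in> \<mu> ` {0..<n}" by (simp only: permutes_image[OF \<mu>]) simp
      then obtain i where i: "i < n" "\<mu> i = j" by auto
      then have "identity_mat e n $$ (\<mu> i, \<rho> (\<mu> i)) = 0"
        using j \<open>j < n\<close> lt[OF \<rho>(1)] by (simp add: identity_mat_def)
      then have "0 \<in> set (map (\<lambda>i. identity_mat e n $$ (\<mu> i, \<rho> (\<mu> i))) [0..<n])"
        using i(1) by (force simp: image_iff)
      then show ?thesis by (rule mult_list_zero)
    qed
    then have "(\<Sum>\<rho>\<in>?S. int_mult (sign \<rho>) (?m \<mu> \<rho>)) = (\<Sum>\<rho>\<in>{id}. int_mult (sign \<rho>) (?m \<mu> \<rho>))"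
      by (intro sum.mono_neutral_right fin) (auto simp: permutes_id int_mult_def)
    also have "\<dots> = ?m \<mu> id" by simp
    also have "map (\<lambda>i. identity_mat e n $$ (\<mu> i, id (\<mu> i))) [0..<n] = replicate n e"
      using lt[OF \<mu>] by (intro nth_equalityI) (auto simp: identity_mat_def)
    finally show ?thesis using mult_list_unit[OF e] n by simp
  qed
  then have "sdet_sum (identity_mat e n) n = (\<Sum>\<mu>\<in>?S. e)"
    unfolding sdet_sum_def by (intro sum.cong) auto
  \<comment> \<open>The constant sum is brought to the initial-segment form in which
    \<open>int_mult\<close> is defined.\<close>
  also have "\<dots> = (\<Sum>\<mu><card ?S. e)"
    using ex_bij_betw_nat_finite[OF fin]
    by (auto simp: atLeast0LessThan dest: sum.reindex_bij_betw[of _ _ _ "\<lambda>_. e"])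
  also have "card ?S = nat (fact n)"
    using nat_int[of "fact n"] card_permutations[of "{0..<n}" n] by (simp only: of_nat_fact) simp
  finally show ?thesis
    by (simp only: int_mult_def fact_ge_zero if_True)
qed

theorem lemma2:
  fixes A :: "'a :: ring mat" and n :: nat
  assumes "division_by_integers TYPE('a)"
    and "n \<ge> 1"
    and "A \<in> carrier_mat n n"
  shows "sdet A = edet A
    \<and> (\<forall>e :: 'a. is_ring_unit e \<longrightarrow> edet (identity_mat e n) = e)"
proof (intro conjI allI impI)
  show "sdet A = edet A"
    using assms sdet_eq_edet by blast
  fix e :: 'a assume e: "is_ring_unit e"
  have dim: "dim_row (identity_mat e n) = n" by (simp add: identity_mat_def)
  \<comment> \<open>The value is computed through \<open>sdet\<close>, where each product off the
    diagonal vanishes by itself.\<close>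
  have "edet (identity_mat e n) = sdet (identity_mat e n)"
    by (rule sdet_eq_edet[OF assms(1,2) dim, symmetric])
  also have "\<dots> = int_div (fact n) (int_mult (fact n) e)"
    by (simp only: sdet_eq[OF dim] sdet_sum_identity[OF e assms(2)])
  also have "\<dots> = e"
    by (rule int_div_int_mult[OF assms(1)]) simp
  finally show "edet (identity_mat e n) = e" .
qed

end
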